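(* Let $K$ be a compact Hausdorff space and let $X$ be a Banach space over $\mathbb{K}\in\{\mathbb{R},\mathbb{C}\}$. Assume either that $X$ is real ($\mathbb{K}=\mathbb{R}$), or that $X$ is complex ($\mathbb{K}=\mathbb{C}$) and $K$ is, in addition, sequentially compact. Then a non-zero element $f\in C(K,X)$ is a left symmetric point of $C(K,X)$ if and only if there is an isolated point $k_0$ of $K$ such that $f=f(k_0)\chi_{\{k_0\}}$ (that is, $f(k)=0$ for all $k\neq k_0$) and $f(k_0)$ is a non-zero left symmetric point of $X$.
   Context: $C(K,X)$ denotes the space of continuous functions $f:K\to X$ with the supremum norm $\|f\|=\sup_{k\in K}\|f(k)\|$, over the same scalar field $\mathbb{K}$ as $X$. In a normed space $Y$ over $\mathbb{K}$, an element $x$ is Birkhoff-James orthogonal to $y$, written $x\perp_{BJ}y$, if $\|x+\lambda y\|\ge\|x\|$ for all $\lambda\in\mathbb{K}$. An element $x\in Y$ is a left symmetric point of $Y$ if for all $y\in Y$, $x\perp_{BJ}y$ implies $y\perp_{BJ}x$. $\chi_{\{k_0\}}$ denotes the characteristic function of $\{k_0\}$. *)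

theory Defs
  imports "HOL-Analysis.Analysis"
begin

section \<open>Complex normed and Banach spaces\<close>

text \<open>A complex normed space is a real normed space carrying in addition a complex scalar
  multiplication that extends the real one and for which the norm is absolutely homogeneous.\<close>

class scaleC =
  fixes scaleC :: "complex \<Rightarrow> 'a \<Rightarrow> 'a"  (infixr \<open>*\<^sub>C\<close> 75)

class complex_normed_vector = real_normed_vector + scaleC +
  assumes scaleC_add_right: "a *\<^sub>C (x + y) = a *\<^sub>C x + a *\<^sub>C y"
    and scaleC_add_left: "(a + b) *\<^sub>C x = a *\<^sub>C x + b *\<^sub>C x"
    and scaleC_scaleC: "a *\<^sub>C b *\<^sub>C x = (a * b) *\<^sub>C x"
    and scaleC_one: "1 *\<^sub>C x = x"
    and scaleC_of_real: "complex_of_real r *\<^sub>C x = r *\<^sub>R x"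
    and norm_scaleC: "norm (a *\<^sub>C x) = cmod a * norm x"

class complex_banach = complex_normed_vector + complete_space

instantiation complex :: complex_banach
begin

definition scaleC_complex :: "complex \<Rightarrow> complex \<Rightarrow> complex"
  where "scaleC_complex a x = a * x"

instance
  by standard (simp_all add: scaleC_complex_def algebra_simps norm_mult scaleR_conv_of_real)

end


section \<open>The space of continuous functions on a compact space\<close>

text \<open>For compact \<open>K\<close> every continuous function is bounded, so that the type of bounded
  continuous functions with its library norm is \<open>C(K,X)\<close> with the supremum norm.\<close>

lemma bcontfun_compact_iff:
  fixes f :: "'k::topological_space \<Rightarrow> 'a::metric_space"
  assumes "compact (UNIV :: 'k set)"
  shows "f \<in> bcontfun \<longleftrightarrow> continuous_on UNIV f"
  using compact_imp_bounded[OF compact_continuous_image[OF _ assms]]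
  by (auto simp: bcontfun_def)

lemma norm_bcontfun_eq_SUP:
  fixes f :: "'k::topological_space \<Rightarrow>\<^sub>C 'a::real_normed_vector"
  shows "norm f = (SUP k. norm (apply_bcontfun f k))"
  by (simp add: norm_bcontfun_def dist_bcontfun.rep_eq)

lemma bounded_linear_scaleC: "bounded_linear (\<lambda>x::'a::complex_normed_vector. c *\<^sub>C x)"
proof (rule bounded_linear_intro[where K = "cmod c"])
  fix r :: real and x :: 'a
  show "c *\<^sub>C r *\<^sub>R x = r *\<^sub>R c *\<^sub>C x"
    by (simp add: scaleC_of_real[symmetric] scaleC_scaleC mult.commute)
qed (simp_all add: scaleC_add_right norm_scaleC)

lemma scaleC_bcontfun_closed:
  fixes f :: "'k::topological_space \<Rightarrow>\<^sub>C 'a::complex_normed_vector"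
  shows "(\<lambda>k. c *\<^sub>C apply_bcontfun f k) \<in> bcontfun"
proof (rule bcontfun_normI)
  show "continuous_on UNIV (\<lambda>k. c *\<^sub>C apply_bcontfun f k)"
    by (rule bounded_linear.continuous_on[OF bounded_linear_scaleC]) simp
  show "norm (c *\<^sub>C apply_bcontfun f k) \<le> cmod c * norm f" for k
    by (simp add: norm_scaleC norm_bounded mult_left_mono)
qed

instantiation bcontfun :: (topological_space, complex_normed_vector) complex_normed_vector
begin

definition scaleC_bcontfun :: "complex \<Rightarrow> ('a \<Rightarrow>\<^sub>C 'b) \<Rightarrow> 'a \<Rightarrow>\<^sub>C 'b"
  where "scaleC_bcontfun c f = Bcontfun (\<lambda>k. c *\<^sub>C apply_bcontfun f k)"

lemma apply_bcontfun_scaleC [simp]: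
  fixes f :: "'a \<Rightarrow>\<^sub>C 'b"
  shows "apply_bcontfun (c *\<^sub>C f) k = c *\<^sub>C apply_bcontfun f k"
  by (simp add: scaleC_bcontfun_def Bcontfun_inverse scaleC_bcontfun_closed)

instance
proof
  fix a b :: complex and r :: real and x y :: "'a \<Rightarrow>\<^sub>C 'b"
  show "a *\<^sub>C (x + y) = a *\<^sub>C x + a *\<^sub>C y"
    by (rule bcontfun_eqI) (simp add: scaleC_add_right)
  show "(a + b) *\<^sub>C x = a *\<^sub>C x + b *\<^sub>C x"
    by (rule bcontfun_eqI) (simp add: scaleC_add_left)
  show *: "a *\<^sub>C b *\<^sub>C x = (a * b) *\<^sub>C x" for a b and x :: "'a \<Rightarrow>\<^sub>C 'b"
    by (rule bcontfun_eqI) (simp add: scaleC_scaleC)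
  show one: "1 *\<^sub>C x = x" for x :: "'a \<Rightarrow>\<^sub>C 'b"
    by (rule bcontfun_eqI) (simp add: scaleC_one)
  show "complex_of_real r *\<^sub>C x = r *\<^sub>R x"
    by (rule bcontfun_eqI) (simp add: scaleC_of_real)
  have le: "norm (a *\<^sub>C x) \<le> cmod a * norm x" for a and x :: "'a \<Rightarrow>\<^sub>C 'b"
    by (rule norm_bound) (simp add: norm_scaleC norm_bounded mult_left_mono)
  show "norm (a *\<^sub>C x) = cmod a * norm x"
  proof (cases "a = 0")
    case True
    with le[of 0 x] show ?thesis by simp
  next
    case False
    have "norm x = norm (inverse a *\<^sub>C a *\<^sub>C x)"
      using False by (simp add: * one)
    also have "\<dots> \<le> norm (a *\<^sub>C x) / cmod a"
      using le[of "inverse a" "a *\<^sub>C x"] by (simp add: norm_inverse divide_inverse mult.commute)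
    finally show ?thesis
      using False le[of a x] by (simp add: field_simps)
  qed
qed

end


section \<open>Birkhoff-James orthogonality and left symmetric points\<close>

text \<open>The scalar multiplication is a parameter, so that the same definitions serve
  real normed spaces (with \<^const>\<open>scaleR\<close>) and complex ones (with \<^const>\<open>scaleC\<close>);
  the choice matters, since orthogonality over \<open>\<complex>\<close> is stronger than over \<open>\<real>\<close>.\<close>

definition BJ_orthogonal :: "('s \<Rightarrow> 'a \<Rightarrow> 'a) \<Rightarrow> 'a::real_normed_vector \<Rightarrow> 'a \<Rightarrow> bool"
  where "BJ_orthogonal sm x y \<longleftrightarrow> (\<forall>c. norm (x + sm c y) \<ge> norm x)"

definition left_symmetric_point :: "('s \<Rightarrow> 'a \<Rightarrow> 'a) \<Rightarrow> 'a::real_normed_vector \<Rightarrow> bool"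
  where "left_symmetric_point sm x \<longleftrightarrow>
    (\<forall>y. BJ_orthogonal sm x y \<longrightarrow> BJ_orthogonal sm y x)"

end

theory Submission
  imports Defs
begin

text \<open>
  Left symmetry of a function \<open>f\<close> in \<open>C(K,X)\<close> is tested against the cut-offs \<open>g = \<phi> f\<close>. By
  compactness \<open>f\<close> attains its norm at some \<open>k\<^sub>0\<close>. If \<open>f\<close> were non-zero at another point \<open>k\<^sub>1\<close>, Urysohn's
  lemma would give a continuous \<open>\<phi>\<close> with values in \<open>[0,1]\<close>, \<open>\<phi> k\<^sub>0 = 0\<close> and \<open>\<phi> k\<^sub>1 = 1\<close>. Then \<open>f\<close> is
  orthogonal to \<open>\<phi> f\<close>, because adding a multiple of \<open>\<phi> f\<close> does not change the value at \<open>k\<^sub>0\<close>; but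
  \<open>\<phi> f\<close> is not orthogonal to \<open>f\<close>, because subtracting \<open>t f\<close> with \<open>t > 0\<close> small lowers the norm of
  \<open>\<phi> f\<close> wherever that norm is nearly attained (lemma \<open>norm_cutoff_minus_less\<close>). So a left symmetric
  \<open>f \<noteq> 0\<close> lives on the single point \<open>k\<^sub>0\<close>, which is isolated since \<open>{k. f k \<noteq> 0}\<close> is open.

  For such one-point functions, orthogonality to \<open>g\<close> is the same as orthogonality of \<open>f k\<^sub>0\<close> to
  \<open>g k\<^sub>0\<close>. The only obstacle is that large multiples of \<open>g\<close> may be large away from \<open>k\<^sub>0\<close>, and it
  disappears because orthogonality depends only on small scalars, by convexity of the norm.
  Orthogonality of \<open>g k\<^sub>0\<close> to \<open>f k\<^sub>0\<close> passes to \<open>g\<close> and \<open>f\<close> because \<open>f\<close> leaves the other values of \<open>g\<close>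
  untouched. In the other direction, isolation of \<open>k\<^sub>0\<close> makes every vector \<open>y\<close> the value at \<open>k\<^sub>0\<close> of a
  continuous function vanishing elsewhere, so left symmetry of \<open>f\<close> can be tested on such functions.

  The argument uses only real scalars to violate orthogonality, and only the size of the scalars to
  establish it, so it is carried out once for an abstract scalar multiplication covering the real
  and the complex case.
\<close>

section \<open>Orthogonality in \<open>C(K,X)\<close> to and from one-point functions\<close>

text \<open>The scalar multiplications of \<open>X\<close> and of \<open>C(K,X)\<close> are both parameters because \<^const>\<open>scaleR\<close>
  and \<^const>\<open>scaleC\<close> are overloaded, and a fixed variable cannot be used at two types.\<close>

locale pointwise_scaling =
  fixes sm :: "'s::real_normed_algebra_1 \<Rightarrow> 'a::real_normed_vector \<Rightarrow> 'a"
    and smF :: "'s \<Rightarrow> ('k::topological_space \<Rightarrow>\<^sub>C 'a) \<Rightarrow> ('k \<Rightarrow>\<^sub>C 'a)"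
  assumes scale_scaleR: "sm (r *\<^sub>R c) x = r *\<^sub>R sm c x"
    and scale_one: "sm 1 x = x"
    and norm_scale: "norm (sm c x) = norm c * norm x"
    and apply_scale: "apply_bcontfun (smF c f) k = sm c (apply_bcontfun f k)"
begin

lemma scale_zero_right: "sm c 0 = 0"
  using norm_scale[of c 0] by simp

lemma scale_of_real: "sm (of_real r) x = r *\<^sub>R x"
  by (simp add: of_real_def scale_scaleR scale_one)

text \<open>Along a line through \<open>x\<close> the norm is convex, so a minimum at \<open>x\<close> that is local is global.\<close>

lemma BJ_orthogonal_if_small_scalars:
  assumes "e > 0" and small: "\<And>c. norm c < e \<Longrightarrow> norm x \<le> norm (x + sm c y)"
  shows "BJ_orthogonal sm x y"
  unfolding BJ_orthogonal_def
proof
  fix c :: 's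
  define t where "t = e / (e + norm c)"
  have pos: "e + norm c > 0"
    using \<open>e > 0\<close> by (simp add: add_pos_nonneg)
  have t: "0 < t" "t \<le> 1"
    using pos \<open>e > 0\<close> by (auto simp: t_def)
  have "norm (t *\<^sub>R c) < e"
    using pos \<open>e > 0\<close> by (simp add: t_def field_simps)
  then have "norm x \<le> norm (x + t *\<^sub>R sm c y)"
    using small scale_scaleR by metis
  also have "x + t *\<^sub>R sm c y = (1 - t) *\<^sub>R x + t *\<^sub>R (x + sm c y)"
    by (simp add: algebra_simps)
  also have "norm \<dots> \<le> (1 - t) * norm x + t * norm (x + sm c y)"
    using t by (intro norm_triangle_le) simp
  finally have "t * norm x \<le> t * norm (x + sm c y)"
    by (simp add: algebra_simps)
  then show "norm x \<le> norm (x + sm c y)"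
    using t by simp
qed

text \<open>Whatever happens to the other values, \<open>f + c g\<close> keeps the value \<open>f k\<^sub>0\<close>, hence the norm.\<close>

lemma BJ_orthogonal_if_zero_at_max:
  assumes "norm (apply_bcontfun f k\<^sub>0) = norm f" and "apply_bcontfun g k\<^sub>0 = 0"
  shows "BJ_orthogonal smF f g"
  unfolding BJ_orthogonal_def
proof
  fix c :: 's
  show "norm f \<le> norm (f + smF c g)"
    using norm_bounded[of "f + smF c g" k\<^sub>0] assms by (simp add: apply_scale scale_zero_right)
qed

lemma BJ_orthogonal_one_point_iff:
  assumes supp: "\<And>k. k \<noteq> k\<^sub>0 \<Longrightarrow> apply_bcontfun f k = 0"
  shows "BJ_orthogonal smF f g \<longleftrightarrow> BJ_orthogonal sm (apply_bcontfun f k\<^sub>0) (apply_bcontfun g k\<^sub>0)"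
    (is "?F \<longleftrightarrow> ?X")
proof
  let ?u = "apply_bcontfun f k\<^sub>0" and ?v = "apply_bcontfun g k\<^sub>0"
  have norm_f: "norm f = norm ?u"
  proof (rule antisym)
    show "norm f \<le> norm ?u"
      by (rule norm_bound) (metis norm_ge_zero norm_zero order_refl supp)
  qed (rule norm_bounded)
  show ?F if ?X
    unfolding BJ_orthogonal_def
  proof
    fix c :: 's
    have "norm ?u \<le> norm (?u + sm c ?v)"
      using that by (auto simp: BJ_orthogonal_def)
    also have "\<dots> \<le> norm (f + smF c g)"
      using norm_bounded[of "f + smF c g" k\<^sub>0] by (simp add: apply_scale)
    finally show "norm f \<le> norm (f + smF c g)"
      by (simp add: norm_f)
  qed
  show ?X if ?F
  proof (cases "?u = 0")
    case True
    then show ?thesis by (simp add: BJ_orthogonal_def)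
  next
    case False
    \<comment> \<open>For scalars below \<open>e\<close> the values of \<open>c g\<close> stay below \<open>norm f\<close>, so \<open>f + c g\<close> can
      reach \<open>norm f\<close> only through its value at \<open>k\<^sub>0\<close>.\<close>
    define e where "e = norm ?u / (norm g + 1)"
    have g1: "norm g + 1 > 0"
      by (simp add: add_nonneg_pos)
    show ?thesis
    proof (rule BJ_orthogonal_if_small_scalars)
      show "e > 0"
        using False g1 by (simp add: e_def)
      fix c :: 's
      assume "norm c < e"
      then have "norm c * (norm g + 1) < norm ?u"
        using g1 by (simp add: e_def field_simps)
      then have small: "norm c * norm g < norm ?u"
        by (smt (verit) norm_ge_zero mult_left_mono)
      have "norm (f + smF c g) \<le> max (norm (?u + sm c ?v)) (norm c * norm g)"
      proof (rule norm_bound)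
        fix k
        show "norm (apply_bcontfun (f + smF c g) k) \<le> max (norm (?u + sm c ?v)) (norm c * norm g)"
        proof (cases "k = k\<^sub>0")
          case False
          then have "norm (apply_bcontfun (f + smF c g) k) = norm c * norm (apply_bcontfun g k)"
            by (simp add: apply_scale norm_scale supp)
          also have "\<dots> \<le> norm c * norm g"
            by (intro mult_left_mono norm_bounded) simp
          finally show ?thesis by simp
        qed (simp add: apply_scale)
      qed
      moreover have "norm ?u \<le> norm (f + smF c g)"
        using that norm_f by (simp add: BJ_orthogonal_def)
      ultimately show "norm ?u \<le> norm (?u + sm c ?v)"
        using small by linarith
    qed
  qed
qed

text \<open>The converse orthogonality \<open>g \<perp> f\<close> can be tested at \<open>k\<^sub>0\<close> alone, since \<open>g + c f\<close> differs from
  \<open>g\<close> only there.\<close>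

lemma BJ_orthogonal_to_one_point:
  assumes supp: "\<And>k. k \<noteq> k\<^sub>0 \<Longrightarrow> apply_bcontfun f k = 0"
    and orth: "BJ_orthogonal sm (apply_bcontfun g k\<^sub>0) (apply_bcontfun f k\<^sub>0)"
  shows "BJ_orthogonal smF g f"
  unfolding BJ_orthogonal_def
proof
  fix c :: 's
  show "norm g \<le> norm (g + smF c f)"
  proof (rule norm_bound)
    fix k
    have "norm (apply_bcontfun g k) \<le> norm (apply_bcontfun (g + smF c f) k)"
      using orth by (cases "k = k\<^sub>0")
        (simp_all add: apply_scale supp scale_zero_right BJ_orthogonal_def)
    also have "\<dots> \<le> norm (g + smF c f)"
      by (rule norm_bounded)
    finally show "norm (apply_bcontfun g k) \<le> norm (g + smF c f)" .
  qed
qed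

end

section \<open>Cut-offs of a continuous function\<close>

text \<open>The function \<open>\<phi> f - t f\<close> is small by the choice of \<open>t\<close> where \<open>\<phi> < t\<close>. Where \<open>\<phi> \<ge> t\<close>, its norm is
  \<open>t * norm (f k)\<close> below that of \<open>\<phi> f\<close>; this gain is uniform except where \<open>f\<close> is small, and there
  \<open>\<phi> f\<close> is small as well.\<close>

lemma norm_cutoff_minus_less:
  fixes f g :: "'k::topological_space \<Rightarrow>\<^sub>C 'a::real_normed_vector" and \<phi> :: "'k \<Rightarrow> real"
  assumes g: "\<And>k. apply_bcontfun g k = \<phi> k *\<^sub>R apply_bcontfun f k"
    and \<phi>: "\<And>k. 0 \<le> \<phi> k" "\<And>k. \<phi> k \<le> 1"
    and "g \<noteq> 0"
  obtains t where "t > 0" and "norm (g - t *\<^sub>R f) < norm g"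
proof
  define G where "G = norm g"
  define t where "t = G / (2 * (norm f + 1))"
  have G: "G > 0"
    using \<open>g \<noteq> 0\<close> by (simp add: G_def)
  have f1: "norm f + 1 > 0"
    by (simp add: add_nonneg_pos)
  show t: "t > 0"
    using G f1 by (simp add: t_def)
  have tf: "t * norm f \<le> G / 2"
    using G f1 by (simp add: t_def field_simps)
  have "norm (g - t *\<^sub>R f) \<le> max (G / 2) (G - t * (G / 2))"
  proof (rule norm_bound)
    fix k
    let ?n = "norm (apply_bcontfun f k)"
    have eq: "norm (apply_bcontfun (g - t *\<^sub>R f) k) = \<bar>\<phi> k - t\<bar> * ?n"
      by (simp add: g flip: scaleR_left_diff_distrib)
    consider "\<phi> k < t" | "\<phi> k \<ge> t" "?n \<le> G / 2" | "\<phi> k \<ge> t" "?n > G / 2"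
      by linarith
    then show "norm (apply_bcontfun (g - t *\<^sub>R f) k) \<le> max (G / 2) (G - t * (G / 2))"
    proof cases
      case 1
      then have "\<bar>\<phi> k - t\<bar> * ?n \<le> t * norm f"
        using \<phi>(1)[of k] t by (intro mult_mono norm_bounded) auto
      then show ?thesis
        using tf eq by simp
    next
      case 2
      then have "\<bar>\<phi> k - t\<bar> * ?n \<le> 1 * ?n"
        using \<phi>(2)[of k] t by (intro mult_right_mono) auto
      then show ?thesis
        using 2 eq by simp
    next
      case 3
      have "\<phi> k * ?n \<le> G"
        using norm_bounded[of g k] \<phi>(1)[of k] by (simp add: g G_def)
      moreover have "t * (G / 2) \<le> t * ?n"
        using 3 t by (intro mult_left_mono) auto
      ultimately show ?thesis
        using 3 eq by (simp add: left_diff_distrib)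
    qed
  qed
  also have "\<dots> < G"
    using G t by simp
  finally show "norm (g - t *\<^sub>R f) < norm g"
    by (simp add: G_def)
qed

lemma compact_t2_separating_function:
  fixes k\<^sub>0 k\<^sub>1 :: "'k::t2_space"
  assumes "compact (UNIV :: 'k set)" and "k\<^sub>0 \<noteq> k\<^sub>1"
  obtains \<phi> :: "'k \<Rightarrow> real"
  where "continuous_on UNIV \<phi>" "\<And>k. 0 \<le> \<phi> k" "\<And>k. \<phi> k \<le> 1" "\<phi> k\<^sub>0 = 0" "\<phi> k\<^sub>1 = 1"
proof -
  have "normal_space (euclidean :: 'k topology)"
    using assms(1) by (intro compact_Hausdorff_or_regular_imp_normal_space)
      (auto simp: compact_space_def Hausdorff_space_def disjnt_def dest!: hausdorff)
  then obtain \<phi> where "continuous_map euclidean (top_of_set {0..1::real}) \<phi>"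
      "\<phi> ` {k\<^sub>0} \<subseteq> {0}" "\<phi> ` {k\<^sub>1} \<subseteq> {1}"
    using Urysohn_lemma[of euclidean "{k\<^sub>0}" "{k\<^sub>1}" 0 1] assms(2) by auto
  then show ?thesis
    using that[of \<phi>] by (force simp: continuous_map_in_subtopology Pi_iff)
qed

lemma bcontfun_attains_norm:
  fixes f :: "'k::topological_space \<Rightarrow>\<^sub>C 'a::real_normed_vector"
  assumes "compact (UNIV :: 'k set)"
  obtains k where "norm (apply_bcontfun f k) = norm f"
proof -
  have "continuous_on UNIV (\<lambda>k. norm (apply_bcontfun f k))"
    by (intro continuous_intros) simp
  then obtain k where "\<And>j. norm (apply_bcontfun f j) \<le> norm (apply_bcontfun f k)"
    using continuous_attains_sup[OF assms] by auto
  then have "norm f \<le> norm (apply_bcontfun f k)"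
    by (rule norm_bound)
  then show ?thesis
    using that norm_bounded[of f k] by (simp add: antisym)
qed

section \<open>Left symmetric points of \<open>C(K,X)\<close>\<close>

locale pointwise_scaling_compact = pointwise_scaling sm smF
  for sm :: "'s::real_normed_algebra_1 \<Rightarrow> 'a::real_normed_vector \<Rightarrow> 'a"
    and smF :: "'s \<Rightarrow> ('k::t2_space \<Rightarrow>\<^sub>C 'a) \<Rightarrow> ('k \<Rightarrow>\<^sub>C 'a)" +
  assumes compact: "compact (UNIV :: 'k set)"
begin

lemma left_symmetric_point_imp_one_point:
  assumes sym: "left_symmetric_point smF f"
    and max: "norm (apply_bcontfun f k\<^sub>0) = norm f"
    and "k \<noteq> k\<^sub>0"
  shows "apply_bcontfun f k = 0"
proof (rule ccontr)
  assume nz: "apply_bcontfun f k \<noteq> 0"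
  obtain \<phi> :: "'k \<Rightarrow> real" where \<phi>: "continuous_on UNIV \<phi>" "\<And>k. 0 \<le> \<phi> k" "\<And>k. \<phi> k \<le> 1"
      "\<phi> k\<^sub>0 = 0" "\<phi> k = 1"
    using compact_t2_separating_function[OF compact] \<open>k \<noteq> k\<^sub>0\<close> by metis
  define g where "g = Bcontfun (\<lambda>k. \<phi> k *\<^sub>R apply_bcontfun f k)"
  have "continuous_on UNIV (\<lambda>k. \<phi> k *\<^sub>R apply_bcontfun f k)"
    using \<phi>(1) by (intro continuous_intros) auto
  then have g: "apply_bcontfun g k = \<phi> k *\<^sub>R apply_bcontfun f k" for k
    by (simp add: g_def Bcontfun_inverse bcontfun_compact_iff[OF compact])
  have "g \<noteq> 0"
    using g[of k] nz \<phi>(5) by auto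
  then obtain t where t: "norm (g - t *\<^sub>R f) < norm g"
    using norm_cutoff_minus_less[OF g \<phi>(2,3)] by blast
  have "BJ_orthogonal smF f g"
    by (rule BJ_orthogonal_if_zero_at_max[OF max]) (simp add: g \<phi>(4))
  then have "BJ_orthogonal smF g f"
    using sym by (simp add: left_symmetric_point_def)
  then have "norm g \<le> norm (g + smF (of_real (- t)) f)"
    by (simp only: BJ_orthogonal_def)
  also have "g + smF (of_real (- t)) f = g - t *\<^sub>R f"
    by (rule bcontfun_eqI) (simp only: plus_bcontfun.rep_eq minus_bcontfun.rep_eq
        scaleR_bcontfun.rep_eq apply_scale scale_of_real, simp)
  finally show False
    using t by simp
qed

theorem left_symmetric_point_bcontfun_iff:
  assumes "f \<noteq> 0"
  shows "left_symmetric_point smF f \<longleftrightarrow>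
    (\<exists>k\<^sub>0. k\<^sub>0 isolated_in UNIV \<and> (\<forall>k. k \<noteq> k\<^sub>0 \<longrightarrow> apply_bcontfun f k = 0) \<and>
      apply_bcontfun f k\<^sub>0 \<noteq> 0 \<and> left_symmetric_point sm (apply_bcontfun f k\<^sub>0))"
proof
  assume sym: "left_symmetric_point smF f"
  obtain k\<^sub>0 where max: "norm (apply_bcontfun f k\<^sub>0) = norm f"
    by (rule bcontfun_attains_norm[OF compact])
  have supp: "apply_bcontfun f k = 0" if "k \<noteq> k\<^sub>0" for k
    using left_symmetric_point_imp_one_point[OF sym max that] .
  have nz: "apply_bcontfun f k\<^sub>0 \<noteq> 0"
    using max assms by auto
  have "open {k. apply_bcontfun f k \<noteq> 0}"
    by (intro open_Collect_neq) auto
  also have "{k. apply_bcontfun f k \<noteq> 0} = {k\<^sub>0}"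
    using supp nz by auto
  finally have op: "open {k\<^sub>0}" .
  have "left_symmetric_point sm (apply_bcontfun f k\<^sub>0)"
    unfolding left_symmetric_point_def
  proof (intro allI impI)
    fix y
    assume orth: "BJ_orthogonal sm (apply_bcontfun f k\<^sub>0) y"
    define g where "g = Bcontfun (\<lambda>k. if k = k\<^sub>0 then y else 0)"
    have "continuous_on {k\<^sub>0} (\<lambda>k. if k = k\<^sub>0 then y else 0)"
      by simp
    moreover have "continuous_on (- {k\<^sub>0}) (\<lambda>k. if k = k\<^sub>0 then y else 0)"
      by (rule continuous_on_eq[OF continuous_on_const[of _ 0]]) simp
    ultimately have "continuous_on ({k\<^sub>0} \<union> - {k\<^sub>0}) (\<lambda>k. if k = k\<^sub>0 then y else 0)"
      using op by (intro continuous_on_open_Un) auto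
    then have g: "apply_bcontfun g k = (if k = k\<^sub>0 then y else 0)" for k
      by (simp add: g_def Bcontfun_inverse bcontfun_compact_iff[OF compact])
    have "BJ_orthogonal smF f g"
      using orth by (simp add: BJ_orthogonal_one_point_iff[OF supp] g)
    then have "BJ_orthogonal smF g f"
      using sym by (simp add: left_symmetric_point_def)
    then show "BJ_orthogonal sm y (apply_bcontfun f k\<^sub>0)"
      using BJ_orthogonal_one_point_iff[of k\<^sub>0 g f] by (simp add: g)
  qed
  then show "\<exists>k\<^sub>0. k\<^sub>0 isolated_in UNIV \<and> (\<forall>k. k \<noteq> k\<^sub>0 \<longrightarrow> apply_bcontfun f k = 0) \<and>
      apply_bcontfun f k\<^sub>0 \<noteq> 0 \<and> left_symmetric_point sm (apply_bcontfun f k\<^sub>0)"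
    using op supp nz by (auto simp: isolated_in_def intro!: exI[of _ k\<^sub>0] exI[of _ "{k\<^sub>0}"])
next
  assume "\<exists>k\<^sub>0. k\<^sub>0 isolated_in UNIV \<and> (\<forall>k. k \<noteq> k\<^sub>0 \<longrightarrow> apply_bcontfun f k = 0) \<and>
      apply_bcontfun f k\<^sub>0 \<noteq> 0 \<and> left_symmetric_point sm (apply_bcontfun f k\<^sub>0)"
  then obtain k\<^sub>0 where supp: "\<And>k. k \<noteq> k\<^sub>0 \<Longrightarrow> apply_bcontfun f k = 0"
      and sym: "left_symmetric_point sm (apply_bcontfun f k\<^sub>0)"
    by blast
  show "left_symmetric_point smF f"
    unfolding left_symmetric_point_def
  proof (intro allI impI)
    fix g
    assume "BJ_orthogonal smF f g"
    then have "BJ_orthogonal sm (apply_bcontfun f k\<^sub>0) (apply_bcontfun g k\<^sub>0)"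
      by (simp add: BJ_orthogonal_one_point_iff[OF supp])
    then show "BJ_orthogonal smF g f"
      using sym by (intro BJ_orthogonal_to_one_point[OF supp]) (auto simp: left_symmetric_point_def)
  qed
qed

end

lemma eq_indicator_scaleR_iff:
  fixes h :: "'k \<Rightarrow> 'a::real_vector"
  shows "h = (\<lambda>k. indicator {k\<^sub>0} k *\<^sub>R h k\<^sub>0) \<longleftrightarrow> (\<forall>k. k \<noteq> k\<^sub>0 \<longrightarrow> h k = 0)"
  by (auto simp: fun_eq_iff indicator_def)

lemma eq_indicator_scaleC_iff:
  fixes h :: "'k \<Rightarrow> 'a::complex_normed_vector"
  shows "h = (\<lambda>k. indicator {k\<^sub>0} k *\<^sub>C h k\<^sub>0) \<longleftrightarrow> (\<forall>k. k \<noteq> k\<^sub>0 \<longrightarrow> h k = 0)"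
proof -
  have "indicator {k\<^sub>0} k *\<^sub>C x = indicator {k\<^sub>0} k *\<^sub>R x" for k and x :: 'a
    using scaleC_of_real[of "indicator {k\<^sub>0} k" x] by (cases "k = k\<^sub>0") simp_all
  then show ?thesis
    by (simp add: eq_indicator_scaleR_iff[symmetric])
qed

theorem theorem2p5:
  assumes "compact (UNIV :: 'k::t2_space set)"
  shows
    "(\<forall>f :: 'k \<Rightarrow>\<^sub>C 'a::banach. f \<noteq> 0 \<longrightarrow>
        (left_symmetric_point (scaleR :: real \<Rightarrow> _) f \<longleftrightarrow>
          (\<exists>k\<^sub>0. k\<^sub>0 isolated_in UNIV \<and>
            apply_bcontfun f = (\<lambda>k. indicator {k\<^sub>0} k *\<^sub>R apply_bcontfun f k\<^sub>0) \<and>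
            apply_bcontfun f k\<^sub>0 \<noteq> 0 \<and>
            left_symmetric_point (scaleR :: real \<Rightarrow> _) (apply_bcontfun f k\<^sub>0))))
     \<and>
     (seq_compact (UNIV :: 'k set) \<longrightarrow>
       (\<forall>f :: 'k \<Rightarrow>\<^sub>C 'b::complex_banach. f \<noteq> 0 \<longrightarrow>
        (left_symmetric_point (scaleC :: complex \<Rightarrow> _) f \<longleftrightarrow>
          (\<exists>k\<^sub>0. k\<^sub>0 isolated_in UNIV \<and>
            apply_bcontfun f = (\<lambda>k. indicator {k\<^sub>0} k *\<^sub>C apply_bcontfun f k\<^sub>0) \<and>
            apply_bcontfun f k\<^sub>0 \<noteq> 0 \<and>
            left_symmetric_point (scaleC :: complex \<Rightarrow> _) (apply_bcontfun f k\<^sub>0)))))"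
proof -
  interpret R: pointwise_scaling_compact "scaleR :: real \<Rightarrow> 'a \<Rightarrow> 'a"
      "scaleR :: real \<Rightarrow> ('k \<Rightarrow>\<^sub>C 'a) \<Rightarrow> _"
    by unfold_locales (simp_all add: assms)
  interpret C: pointwise_scaling_compact "scaleC :: complex \<Rightarrow> 'b \<Rightarrow> 'b"
      "scaleC :: complex \<Rightarrow> ('k \<Rightarrow>\<^sub>C 'b) \<Rightarrow> _"
    by unfold_locales
      (simp_all add: assms scaleC_one norm_scaleC scaleR_conv_of_real
        flip: scaleC_scaleC scaleC_of_real)
  show ?thesis
    unfolding eq_indicator_scaleR_iff eq_indicator_scaleC_iff
    using R.left_symmetric_point_bcontfun_iff C.left_symmetric_point_bcontfun_iff by blast
qed

end
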